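(* Let $\mathscr{F}\subseteq\mathscr{P}(\omega)$ be an $\omega$-closed family with $\varnothing\in\mathscr{F}$ and suppose that $\boldsymbol{B}_{\omega}^{\mathscr{F}}$ is a $0$-bisimple semigroup. Then exactly one of the following conditions holds: (1) the semigroup $\boldsymbol{B}_{\omega}^{\mathscr{F}}$ is isomorphic to the semigroup of $\omega\times\omega$-matrix units $\boldsymbol{\mathcal{B}}_\omega$; (2) the semigroup $\boldsymbol{B}_{\omega}^{\mathscr{F}}$ is isomorphic to the bicyclic monoid with adjoined zero; (3) the semigroup $\boldsymbol{B}_{\omega}^{\mathscr{F}}$ is isomorphic to the semigroup $\boldsymbol{B}_{\omega}^{(0,j_0)}$ for some positive integer $j_0\geqslant 2$.
   Context: $\omega$ is the set of non-negative integers, $\mathscr{P}(\omega)$ its power set. For an integer $n$ and $F\subseteq\omega$ put $n+F=\{n+k\colon k\in F\}\subseteq\mathbb{Z}$ (empty if $F=\varnothing$). A family $\mathscr{F}\subseteq\mathscr{P}(\omega)$ is $\omega$-closed if $F_1\cap(-n+F_2)\in\mathscr{F}$ for all $n\in\omega$ and $F_1,F_2\in\mathscr{F}$. For an $\omega$-closed family $\mathscr{F}$, the set $\boldsymbol{B}_{\omega}\times\mathscr{F}=\omega\times\omega\times\mathscr{F}$ carries the semigroup operation $$(i_1,j_1,F_1)\cdot(i_2,j_2,F_2)=\begin{cases}(i_1-j_1+i_2,\,j_2,\,(j_1-i_2+F_1)\cap F_2), & j_1\leqslant i_2;\\ (i_1,\,j_1-i_2+j_2,\,F_1\cap(i_2-j_1+F_2)),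 & j_1\geqslant i_2.\end{cases}$$ If $\varnothing\in\mathscr{F}$, then $\boldsymbol{I}=\{(i,j,\varnothing)\colon i,j\in\omega\}$ is an ideal and $\boldsymbol{B}_{\omega}^{\mathscr{F}}$ is the Rees quotient $(\boldsymbol{B}_{\omega}\times\mathscr{F},\cdot)/\boldsymbol{I}$, in which all $(i,j,\varnothing)$ are identified to a single zero element $\boldsymbol{0}$. An inverse semigroup $S$ with zero $0$ is $0$-bisimple if it has exactly two $\mathscr{D}$-classes, $S\setminus\{0\}$ and $\{0\}$; every $\boldsymbol{B}_{\omega}^{\mathscr{F}}$ is an inverse semigroup. For $i_0\in\omega$ and a positive integer $j_0$, with $j_0\omega=\{j_0\cdot i\colon i\in\omega\}$, put $\boldsymbol{B}_{\omega}^{(i_0,j_0)}=\boldsymbol{B}_{\omega}^{\mathscr{F}}$ for the $\omega$-closed family $\mathscr{F}=\{\varnothing,\,i_0+j_0\omega\}$. The semigroup of $\omega\times\omega$-matrix units is $\boldsymbol{\mathcal{B}}_\omega=(\omega\times\omega)\sqcup\{0\}$ with $(a,b)\cdot(c,d)=(a,d)$ if $b=c$, $(a,b)\cdot(c,d)=0$ if $b\neq c$, and all products involving $0$ equal to $0$. The bicyclic monoid is the monoid generated by $\{p,q\}$ subject to the single relation $pq=1$; equivalently, $\omega\times\omega$ with $(i_1,j_1)\cdot(i_2,j_2)=(i_1+i_2-\min\{j_1,i_2\},\,j_1+j_2-\min\{j_1,i_2\})$. *)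

theory Defs
  imports "HOL-Algebra.Group"
begin

text \<open>
  Semigroups are represented by the monoid records of HOL-Algebra, so that
  \<^const>\<open>hom\<close>, \<^const>\<open>iso\<close> and \<^const>\<open>is_iso\<close> can be used; these refer only to the
  carrier and the multiplication. Where a semigroup is not meant to have an identity,
  the field \<open>one\<close> is left undefined and is never used.
\<close>

section \<open>Semigroups, inverse semigroups and Green's relations\<close>

definition semigroup_on :: "('a, 'b) monoid_scheme \<Rightarrow> bool" where
  "semigroup_on S \<longleftrightarrow>
     (\<forall>x\<in>carrier S. \<forall>y\<in>carrier S. x \<otimes>\<^bsub>S\<^esub> y \<in> carrier S) \<and>
     (\<forall>x\<in>carrier S. \<forall>y\<in>carrier S. \<forall>z\<in>carrier S.
        (x \<otimes>\<^bsub>S\<^esub> y) \<otimes>\<^bsub>S\<^esub> z = x \<otimes>\<^bsub>S\<^esub> (y \<otimes>\<^bsub>S\<^esub> z))"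

definition inverse_semigroup :: "('a, 'b) monoid_scheme \<Rightarrow> bool" where
  "inverse_semigroup S \<longleftrightarrow> semigroup_on S \<and>
     (\<forall>x\<in>carrier S. \<exists>!y. y \<in> carrier S \<and>
        x \<otimes>\<^bsub>S\<^esub> y \<otimes>\<^bsub>S\<^esub> x = x \<and> y \<otimes>\<^bsub>S\<^esub> x \<otimes>\<^bsub>S\<^esub> y = y)"

definition is_zero :: "('a, 'b) monoid_scheme \<Rightarrow> 'a \<Rightarrow> bool" where
  "is_zero S z \<longleftrightarrow> z \<in> carrier S \<and>
     (\<forall>x\<in>carrier S. z \<otimes>\<^bsub>S\<^esub> x = z \<and> x \<otimes>\<^bsub>S\<^esub> z = z)"

text \<open>The principal one-sided ideals \<open>S\<^sup>1a = Sa \<union> {a}\<close> and \<open>aS\<^sup>1 = aS \<union> {a}\<close>.\<close>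

definition left_ideal_of :: "('a, 'b) monoid_scheme \<Rightarrow> 'a \<Rightarrow> 'a set" where
  "left_ideal_of S a = insert a {s \<otimes>\<^bsub>S\<^esub> a | s. s \<in> carrier S}"

definition right_ideal_of :: "('a, 'b) monoid_scheme \<Rightarrow> 'a \<Rightarrow> 'a set" where
  "right_ideal_of S a = insert a {a \<otimes>\<^bsub>S\<^esub> s | s. s \<in> carrier S}"

definition green_L :: "('a, 'b) monoid_scheme \<Rightarrow> ('a \<times> 'a) set" where
  "green_L S = {(a, b). a \<in> carrier S \<and> b \<in> carrier S \<and> left_ideal_of S a = left_ideal_of S b}"

definition green_R :: "('a, 'b) monoid_scheme \<Rightarrow> ('a \<times> 'a) set" where
  "green_R S = {(a, b). a \<in> carrier S \<and> b \<in> carrier S \<and> right_ideal_of S a = right_ideal_of S b}"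

definition green_D :: "('a, 'b) monoid_scheme \<Rightarrow> ('a \<times> 'a) set" where
  "green_D S = green_L S O green_R S"

text \<open>
  In the following definition the two classes are distinct and nonempty, because the
  members of the quotient \<open>carrier S // green_D S\<close> are nonempty: the trivial semigroup is
  not \<open>0\<close>-bisimple.
\<close>

definition zero_bisimple :: "('a, 'b) monoid_scheme \<Rightarrow> bool" where
  "zero_bisimple S \<longleftrightarrow> inverse_semigroup S \<and>
     (\<exists>z. is_zero S z \<and> carrier S // green_D S = {carrier S - {z}, {z}})"


section \<open>Rees quotients and adjoined zeros\<close>

definition rees_cong :: "('a, 'b) monoid_scheme \<Rightarrow> 'a set \<Rightarrow> ('a \<times> 'a) set" where
  "rees_cong S I = {(x, y). x \<in> carrier S \<and> y \<in> carrier S \<and> (x = y \<or> x \<in> I \<and> y \<in> I)}"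

text \<open>
  The elements of the Rees quotient are the congruence classes. If \<open>I\<close> is an ideal, all
  classes in the union defining the product coincide.
\<close>

definition rees_quotient :: "('a, 'b) monoid_scheme \<Rightarrow> 'a set \<Rightarrow> 'a set monoid" where
  "rees_quotient S I =
     \<lparr>carrier = carrier S // rees_cong S I,
      mult = (\<lambda>A B. \<Union>a\<in>A. \<Union>b\<in>B. rees_cong S I `` {a \<otimes>\<^bsub>S\<^esub> b}),
      one = undefined\<rparr>"

definition adjoin_zero :: "('a, 'b) monoid_scheme \<Rightarrow> 'a option monoid" where
  "adjoin_zero S =
     \<lparr>carrier = insert None (Some ` carrier S),
      mult = (\<lambda>x y. case (x, y) of (Some a, Some b) \<Rightarrow> Some (a \<otimes>\<^bsub>S\<^esub> b) | _ \<Rightarrow> None),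
      one = Some \<one>\<^bsub>S\<^esub>\<rparr>"


section \<open>The semigroup defined by an \<open>\<omega>\<close>-closed family\<close>

text \<open>
  \<open>shift n F\<close> is the part of \<open>n + F \<subseteq> \<int>\<close> that lies in \<open>\<omega>\<close>. Nothing is lost by this
  truncation, as shifted sets are only ever intersected with subsets of \<open>\<omega>\<close>.
\<close>

definition shift :: "int \<Rightarrow> nat set \<Rightarrow> nat set" where
  "shift n F = {m. \<exists>k\<in>F. int m = n + int k}"

definition omega_closed :: "nat set set \<Rightarrow> bool" where
  "omega_closed \<F> \<longleftrightarrow> (\<forall>n::nat. \<forall>F1\<in>\<F>. \<forall>F2\<in>\<F>. F1 \<inter> shift (- int n) F2 \<in> \<F>)"

text \<open>
  The summands in the first two coordinates are ordered so that the subtraction on the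
  natural numbers is exact in either case.
\<close>

fun bw_mult :: "nat \<times> nat \<times> nat set \<Rightarrow> nat \<times> nat \<times> nat set \<Rightarrow> nat \<times> nat \<times> nat set" where
  "bw_mult (i1, j1, F1) (i2, j2, F2) =
     (if j1 \<le> i2
      then (i1 + i2 - j1, j2, shift (int j1 - int i2) F1 \<inter> F2)
      else (i1, j1 + j2 - i2, F1 \<inter> shift (int i2 - int j1) F2))"

definition bw_prod :: "nat set set \<Rightarrow> (nat \<times> nat \<times> nat set) monoid" where
  "bw_prod \<F> = \<lparr>carrier = UNIV \<times> UNIV \<times> \<F>, mult = bw_mult, one = undefined\<rparr>"

definition bw_ideal :: "(nat \<times> nat \<times> nat set) set" where
  "bw_ideal = {(i, j, {}) | i j. True}"

text \<open>This is the intended semigroup only in the case \<open>{} \<in> \<F>\<close>.\<close>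

definition BwF :: "nat set set \<Rightarrow> (nat \<times> nat \<times> nat set) set monoid" where
  "BwF \<F> = rees_quotient (bw_prod \<F>) bw_ideal"

definition Bw_progression :: "nat \<Rightarrow> nat \<Rightarrow> (nat \<times> nat \<times> nat set) set monoid" where
  "Bw_progression i0 j0 = BwF {{}, {i0 + j0 * i | i. True}}"


section \<open>Matrix units and the bicyclic monoid\<close>

definition matrix_units :: "(nat \<times> nat) option monoid" where
  "matrix_units =
     \<lparr>carrier = UNIV,
      mult = (\<lambda>x y. case (x, y) of
                (Some (a, b), Some (c, d)) \<Rightarrow> if b = c then Some (a, d) else None
              | _ \<Rightarrow> None),
      one = undefined\<rparr>"

definition bicyclic :: "(nat \<times> nat) monoid" where
  "bicyclic =
     \<lparr>carrier = UNIV,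
      mult = (\<lambda>(i1, j1) (i2, j2). (i1 + i2 - min j1 i2, j1 + j2 - min j1 i2)),
      one = (0, 0)\<rparr>"


definition exactly_one_of_three :: "bool \<Rightarrow> bool \<Rightarrow> bool \<Rightarrow> bool" where
  "exactly_one_of_three P Q R \<longleftrightarrow>
     (P \<and> \<not> Q \<and> \<not> R) \<or> (\<not> P \<and> Q \<and> \<not> R) \<or> (\<not> P \<and> \<not> Q \<and> R)"

end

theory Submission
  imports Defs
begin

text \<open>
  Think of an element \<open>(i, j, F)\<close> as the partial translation of \<open>\<omega>\<close> that takes \<open>i + F\<close> onto
  \<open>j + F\<close>; the product is then composition of partial maps. Multiplying on the left can only
  shrink the set \<open>j + F\<close>, and multiplying on the right can only shrink \<open>i + F\<close>. Hence
  \<open>\<L>\<close>-related nonzero elements share \<open>j\<close> and \<open>F\<close>, \<open>\<R>\<close>-related ones share \<open>i\<close> and \<open>F\<close>, and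
  \<open>F\<close> is an invariant of the \<open>\<D>\<close>-class (\<open>green_D_family\<close>). So \<open>0\<close>-bisimplicity leaves
  exactly one nonempty set \<open>F\<close> in the family (\<open>zero_bisimple_family\<close>).

  Being \<open>\<omega>\<close>-closed now says that \<open>F\<close> and \<open>-n + F\<close> are disjoint or \<open>F \<subseteq> -n + F\<close>. Thus the
  distances from \<open>min F\<close> to the points of \<open>F\<close> form a set closed under addition and
  under subtracting a smaller from a larger one, and \<open>F = i\<^sub>0 + d\<omega>\<close>, where \<open>d = 0\<close> accounts for the singletons
  (\<open>omega_closed_pair\<close>).

  For such \<open>F\<close> the third coordinate of a product of \<open>(i\<^sub>1, j\<^sub>1, F)\<close> and \<open>(i\<^sub>2, j\<^sub>2, F)\<close> is
  \<open>F\<close> or empty according to whether \<open>d\<close> divides \<open>j\<^sub>1 - i\<^sub>2\<close>. The semigroup therefore depends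
  on \<open>d\<close> alone: it is the bicyclic monoid with zero in which the products with
  \<open>d \<nmid> j\<^sub>1 - i\<^sub>2\<close> have been replaced by zero, called \<open>dvd_bicyclic d\<close> below
  (\<open>BwF_progression_iso\<close>). For \<open>d = 0\<close> these are the matrix units, for \<open>d = 1\<close> nothing has
  been replaced, and for \<open>d \<ge> 2\<close> the set \<open>0 + d\<omega>\<close> gives the third case.

  The three cases exclude each other because two properties invariant under isomorphism
  separate them: zero divisors occur unless \<open>d = 1\<close>, and distinct idempotents with nonzero
  product occur unless \<open>d = 0\<close> (\<open>dvd_bicyclic_iso_imp\<close>).
\<close>

section \<open>Rees quotients and isomorphisms of semigroups\<close>

lemma carrier_rees_quotient:
  "carrier (rees_quotient S I) = (\<lambda>x. rees_cong S I `` {x}) ` carrier S"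
  by (auto simp: rees_quotient_def quotient_def)

lemma rees_class_eq_iff:
  assumes "x \<in> carrier S" "y \<in> carrier S"
  shows "rees_cong S I `` {x} = rees_cong S I `` {y} \<longleftrightarrow> x = y \<or> x \<in> I \<and> y \<in> I"
  using assms unfolding rees_cong_def by auto

lemma mult_rees_quotient:
  assumes closed: "\<And>a b. a \<in> carrier S \<Longrightarrow> b \<in> carrier S \<Longrightarrow> a \<otimes>\<^bsub>S\<^esub> b \<in> carrier S"
    and ideal: "\<And>a b. a \<in> carrier S \<Longrightarrow> b \<in> carrier S \<Longrightarrow> a \<in> I \<or> b \<in> I \<Longrightarrow> a \<otimes>\<^bsub>S\<^esub> b \<in> I"
    and x: "x \<in> carrier S" and y: "y \<in> carrier S"
  shows "(rees_cong S I `` {x}) \<otimes>\<^bsub>rees_quotient S I\<^esub> (rees_cong S I `` {y})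
           = rees_cong S I `` {x \<otimes>\<^bsub>S\<^esub> y}"
proof -
  have "rees_cong S I `` {a \<otimes>\<^bsub>S\<^esub> b} = rees_cong S I `` {x \<otimes>\<^bsub>S\<^esub> y}"
    if "a \<in> rees_cong S I `` {x}" "b \<in> rees_cong S I `` {y}" for a b
  proof -
    have ab: "a \<in> carrier S" "b \<in> carrier S"
      and rel: "a = x \<or> a \<in> I \<and> x \<in> I" "b = y \<or> b \<in> I \<and> y \<in> I"
      using that by (auto simp: rees_cong_def)
    have "a \<otimes>\<^bsub>S\<^esub> b = x \<otimes>\<^bsub>S\<^esub> y \<or> a \<otimes>\<^bsub>S\<^esub> b \<in> I \<and> x \<otimes>\<^bsub>S\<^esub> y \<in> I"
      using rel ideal ab x y by blast
    then show ?thesis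
      by (simp add: rees_class_eq_iff closed ab x y)
  qed
  then have "(\<Union>a\<in>rees_cong S I `` {x}. \<Union>b\<in>rees_cong S I `` {y}. rees_cong S I `` {a \<otimes>\<^bsub>S\<^esub> b})
      = (\<Union>a\<in>rees_cong S I `` {x}. \<Union>b\<in>rees_cong S I `` {y}. rees_cong S I `` {x \<otimes>\<^bsub>S\<^esub> y})"
    by (intro SUP_cong refl)
  moreover have "rees_cong S I `` {x} \<noteq> {}" "rees_cong S I `` {y} \<noteq> {}"
    using x y by (auto simp: rees_cong_def)
  ultimately show ?thesis by (simp add: rees_quotient_def)
qed

text \<open>
  Closure keeps a product of preimages inside the carrier of \<open>S\<close>, where the isomorphism is
  injective; this makes the inverse map multiplicative.
\<close>
lemma iso_sym_closed:
  assumes closed: "\<And>a b. a \<in> carrier S \<Longrightarrow> b \<in> carrier S \<Longrightarrow> a \<otimes>\<^bsub>S\<^esub> b \<in> carrier S"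
    and "S \<cong> T"
  shows "T \<cong> S"
proof -
  obtain h where hom: "h \<in> hom S T" and bij: "bij_betw h (carrier S) (carrier T)"
    using \<open>S \<cong> T\<close> by (auto simp: is_iso_def iso_def)
  let ?g = "inv_into (carrier S) h"
  have bij': "bij_betw ?g (carrier T) (carrier S)"
    using bij by (rule bij_betw_inv_into)
  have "?g (x \<otimes>\<^bsub>T\<^esub> y) = ?g x \<otimes>\<^bsub>S\<^esub> ?g y" if "x \<in> carrier T" "y \<in> carrier T" for x y
  proof -
    have g: "?g x \<in> carrier S" "?g y \<in> carrier S"
      using that bij' by (auto dest: bij_betwE)
    have "h (?g x \<otimes>\<^bsub>S\<^esub> ?g y) = x \<otimes>\<^bsub>T\<^esub> y"
      using hom g that bij by (simp add: hom_mult bij_betw_inv_into_right)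
    then show ?thesis
      using bij_betw_inv_into_left[OF bij closed[OF g]] by simp
  qed
  then have "?g \<in> iso T S"
    using bij' by (auto simp: iso_def hom_def dest: bij_betwE)
  then show ?thesis by (rule is_isoI)
qed

section \<open>Green's relations and the members of the family\<close>

lemma mem_left_ideal_of: "left_ideal_of S a = left_ideal_of S b \<Longrightarrow> a \<in> left_ideal_of S b"
  by (auto simp: left_ideal_of_def)

lemma mem_right_ideal_of: "right_ideal_of S a = right_ideal_of S b \<Longrightarrow> a \<in> right_ideal_of S b"
  by (auto simp: right_ideal_of_def)

lemma shift_empty [simp]: "shift n {} = {}"
  by (simp add: shift_def)

lemma shift_zero [simp]: "shift 0 F = F"
  by (auto simp: shift_def)

lemma mem_shift_iff: "m \<in> shift n F \<longleftrightarrow> n \<le> int m \<and> nat (int m - n) \<in> F"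
  unfolding shift_def
proof safe
  assume "n \<le> int m" "nat (int m - n) \<in> F"
  then show "\<exists>k\<in>F. int m = n + int k" by (intro bexI[of _ "nat (int m - n)"]) auto
qed auto

lemma shift_of_nat: "shift (int n) F = (+) n ` F"
  by (auto simp: shift_def image_iff simp flip: of_nat_add)

lemma shift_of_nat_inj: "shift (int n) F = shift (int n) G \<Longrightarrow> F = G"
  by (simp add: shift_of_nat inj_image_eq_iff)

text \<open>
  The range of a composite of partial maps lies in the range of the second factor, and its
  domain in the domain of the first. The inequality between the coordinates is needed as well,
  since \<open>j + F\<close> alone does not determine \<open>(j, F)\<close>.
\<close>
lemma bw_mult_second:
  assumes "bw_mult x (i2, j2, F2) = (i, j, H)"
  shows "j2 \<le> j \<and> shift (int j) H \<subseteq> shift (int j2) F2"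
proof -
  obtain i1 j1 F1 where [simp]: "x = (i1, j1, F1)" by (metis prod_cases3)
  show ?thesis
    using assms by (cases "j1 \<le> i2") (auto simp: shift_def)
qed

lemma bw_mult_first:
  assumes "bw_mult (i1, j1, F1) x = (i, j, H)"
  shows "i1 \<le> i \<and> shift (int i) H \<subseteq> shift (int i1) F1"
proof -
  obtain i2 j2 F2 where [simp]: "x = (i2, j2, F2)" by (metis prod_cases3)
  show ?thesis
    using assms by (cases "j1 \<le> i2") (auto simp: shift_def)
qed

locale omega_family =
  fixes \<F> :: "nat set set"
  assumes closed: "omega_closed \<F>"
    and empty: "{} \<in> \<F>"
begin

lemma bw_mult_closed:
  "x \<in> carrier (bw_prod \<F>) \<Longrightarrow> y \<in> carrier (bw_prod \<F>) \<Longrightarrow>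
     x \<otimes>\<^bsub>bw_prod \<F>\<^esub> y \<in> carrier (bw_prod \<F>)"
proof -
  assume xy: "x \<in> carrier (bw_prod \<F>)" "y \<in> carrier (bw_prod \<F>)"
  obtain i1 j1 F1 i2 j2 F2 where [simp]: "x = (i1, j1, F1)" "y = (i2, j2, F2)"
    by (metis prod_cases3)
  have F: "F1 \<in> \<F>" "F2 \<in> \<F>" using xy by (auto simp: bw_prod_def)
  have cl: "A \<inter> shift (- int n) B \<in> \<F>" if "A \<in> \<F>" "B \<in> \<F>" for A B n
    using closed that by (auto simp: omega_closed_def)
  have "shift (int j1 - int i2) F1 \<inter> F2 \<in> \<F>" if "j1 \<le> i2"
    using cl[OF F(2,1), of "i2 - j1"] that by (simp add: Int_commute of_nat_diff)
  moreover have "F1 \<inter> shift (int i2 - int j1) F2 \<in> \<F>" if "\<not> j1 \<le> i2"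
    using cl[OF F, of "j1 - i2"] that by (simp add: of_nat_diff)
  ultimately show ?thesis by (simp add: bw_prod_def)
qed

definition cls :: "nat \<times> nat \<times> nat set \<Rightarrow> (nat \<times> nat \<times> nat set) set" where
  "cls x = rees_cong (bw_prod \<F>) bw_ideal `` {x}"

lemma carrier_BwF: "carrier (BwF \<F>) = cls ` (UNIV \<times> UNIV \<times> \<F>)"
  unfolding BwF_def carrier_rees_quotient cls_def[abs_def] by (simp add: bw_prod_def)

lemma cls_eq_iff:
  assumes "F \<in> \<F>" "G \<in> \<F>"
  shows "cls (i, j, F) = cls (k, l, G) \<longleftrightarrow> (i, j, F) = (k, l, G) \<or> F = {} \<and> G = {}"
  unfolding cls_def using assms
  by (subst rees_class_eq_iff) (auto simp: bw_prod_def bw_ideal_def)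

lemma mult_cls:
  assumes "F \<in> \<F>" "G \<in> \<F>"
  shows "cls (i, j, F) \<otimes>\<^bsub>BwF \<F>\<^esub> cls (k, l, G) = cls (bw_mult (i, j, F) (k, l, G))"
proof -
  have "a \<otimes>\<^bsub>bw_prod \<F>\<^esub> b \<in> bw_ideal" if "a \<in> bw_ideal \<or> b \<in> bw_ideal" for a b
    using that by (cases a; cases b) (auto simp: bw_ideal_def bw_prod_def)
  from mult_rees_quotient[OF bw_mult_closed this, where x="(i,j,F)" and y="(k,l,G)"] assms
  show ?thesis
    unfolding BwF_def cls_def by (simp add: bw_prod_def)
qed

lemma bw_mult_in_family:
  assumes "F \<in> \<F>" "G \<in> \<F>" "bw_mult (i, j, F) (k, l, G) = (a, b, H)"
  shows "H \<in> \<F>"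
  using bw_mult_closed[of "(i,j,F)" "(k,l,G)"] assms by (simp add: bw_prod_def)

text \<open>
  Classes of triples with nonempty set are singletons, so a nonzero product in the Rees quotient
  is already a product of triples.
\<close>
lemma left_ideal_of_le:
  assumes F: "F1 \<in> \<F>" "F2 \<in> \<F>" "F1 \<noteq> {}"
    and mem: "cls (i1, j1, F1) \<in> left_ideal_of (BwF \<F>) (cls (i2, j2, F2))"
  shows "j2 \<le> j1 \<and> shift (int j1) F1 \<subseteq> shift (int j2) F2"
proof (cases "cls (i1, j1, F1) = cls (i2, j2, F2)")
  case True
  then show ?thesis using F by (auto simp: cls_eq_iff)
next
  case False
  then obtain k l G where G: "G \<in> \<F>"
    and eq: "cls (i1, j1, F1) = cls (k, l, G) \<otimes>\<^bsub>BwF \<F>\<^esub> cls (i2, j2, F2)"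
    using mem by (auto simp: left_ideal_of_def carrier_BwF)
  obtain a b H where prod: "bw_mult (k, l, G) (i2, j2, F2) = (a, b, H)"
    by (metis prod_cases3)
  have "cls (i1, j1, F1) = cls (a, b, H)"
    using eq by (simp only: mult_cls[OF G F(2)] prod)
  then have "bw_mult (k, l, G) (i2, j2, F2) = (i1, j1, F1)"
    using F bw_mult_in_family[OF G F(2) prod] by (auto simp: cls_eq_iff prod simp del: bw_mult.simps)
  from bw_mult_second[OF this] show ?thesis by simp
qed

lemma right_ideal_of_le:
  assumes F: "F1 \<in> \<F>" "F2 \<in> \<F>" "F1 \<noteq> {}"
    and mem: "cls (i1, j1, F1) \<in> right_ideal_of (BwF \<F>) (cls (i2, j2, F2))"
  shows "i2 \<le> i1 \<and> shift (int i1) F1 \<subseteq> shift (int i2) F2"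
proof (cases "cls (i1, j1, F1) = cls (i2, j2, F2)")
  case True
  then show ?thesis using F by (auto simp: cls_eq_iff)
next
  case False
  then obtain k l G where G: "G \<in> \<F>"
    and eq: "cls (i1, j1, F1) = cls (i2, j2, F2) \<otimes>\<^bsub>BwF \<F>\<^esub> cls (k, l, G)"
    using mem by (auto simp: right_ideal_of_def carrier_BwF)
  obtain a b H where prod: "bw_mult (i2, j2, F2) (k, l, G) = (a, b, H)"
    by (metis prod_cases3)
  have "cls (i1, j1, F1) = cls (a, b, H)"
    using eq by (simp only: mult_cls[OF F(2) G] prod)
  then have "bw_mult (i2, j2, F2) (k, l, G) = (i1, j1, F1)"
    using F bw_mult_in_family[OF F(2) G prod] by (auto simp: cls_eq_iff prod simp del: bw_mult.simps)
  from bw_mult_first[OF this] show ?thesis by simp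
qed

lemma shift_eq_empty: "shift (int n) F = {} \<longleftrightarrow> F = {}"
  using shift_of_nat_inj[of n F "{}"] by auto

lemma green_L_family:
  assumes "F1 \<in> \<F>" "F2 \<in> \<F>" "F1 \<noteq> {} \<or> F2 \<noteq> {}"
    and "(cls (i1, j1, F1), cls (i2, j2, F2)) \<in> green_L (BwF \<F>)"
  shows "F1 = F2"
proof -
  have "cls (i1, j1, F1) \<in> left_ideal_of (BwF \<F>) (cls (i2, j2, F2))"
    "cls (i2, j2, F2) \<in> left_ideal_of (BwF \<F>) (cls (i1, j1, F1))"
    using assms(4) mem_left_ideal_of[of "BwF \<F>"] by (simp_all add: green_L_def)
  note le = left_ideal_of_le[OF assms(1,2) _ this(1)] left_ideal_of_le[OF assms(2,1) _ this(2)]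
  have "F1 \<noteq> {}" "F2 \<noteq> {}"
    using le assms(3) by (metis shift_eq_empty subset_empty)+
  then have "j1 = j2" "shift (int j1) F1 = shift (int j2) F2"
    using le by auto
  then show ?thesis using shift_of_nat_inj by blast
qed

lemma green_R_family:
  assumes "F1 \<in> \<F>" "F2 \<in> \<F>" "F1 \<noteq> {} \<or> F2 \<noteq> {}"
    and "(cls (i1, j1, F1), cls (i2, j2, F2)) \<in> green_R (BwF \<F>)"
  shows "F1 = F2"
proof -
  have "cls (i1, j1, F1) \<in> right_ideal_of (BwF \<F>) (cls (i2, j2, F2))"
    "cls (i2, j2, F2) \<in> right_ideal_of (BwF \<F>) (cls (i1, j1, F1))"
    using assms(4) mem_right_ideal_of[of "BwF \<F>"] by (simp_all add: green_R_def)
  note le = right_ideal_of_le[OF assms(1,2) _ this(1)] right_ideal_of_le[OF assms(2,1) _ this(2)]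
  have "F1 \<noteq> {}" "F2 \<noteq> {}"
    using le assms(3) by (metis shift_eq_empty subset_empty)+
  then have "i1 = i2" "shift (int i1) F1 = shift (int i2) F2"
    using le by auto
  then show ?thesis using shift_of_nat_inj by blast
qed

lemma green_D_family:
  assumes F: "F1 \<in> \<F>" "F2 \<in> \<F>" "F2 \<noteq> {}"
    and D: "(cls (i1, j1, F1), cls (i2, j2, F2)) \<in> green_D (BwF \<F>)"
  shows "F1 = F2"
proof -
  obtain C where L: "(cls (i1, j1, F1), C) \<in> green_L (BwF \<F>)"
    and R: "(C, cls (i2, j2, F2)) \<in> green_R (BwF \<F>)"
    using D by (auto simp: green_D_def)
  then obtain k l G where "G \<in> \<F>" "C = cls (k, l, G)"
    by (auto simp: green_L_def carrier_BwF)
  then show ?thesis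
    using green_L_family[of F1 G] green_R_family[of G F2] L R F by blast
qed

lemma is_zero_BwF:
  assumes "is_zero (BwF \<F>) z"
  shows "z = cls (i, j, {})"
proof -
  obtain k l G where z: "G \<in> \<F>" "z = cls (k, l, G)"
    using assms by (auto simp: is_zero_def carrier_BwF)
  have "z = z \<otimes>\<^bsub>BwF \<F>\<^esub> cls (i, j, {})"
    using assms empty by (auto simp: is_zero_def carrier_BwF)
  also have "\<dots> = cls (i, j, {})"
    using z empty by (auto simp: mult_cls cls_eq_iff)
  finally show ?thesis .
qed

text \<open>
  The class of nonzero elements is nonempty, which yields one nonempty set \<open>F\<close>; any other
  nonempty member \<open>G\<close> would give the element \<open>(0, 0, G)\<close> in the same \<open>\<D>\<close>-class.
\<close>
lemma zero_bisimple_family: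
  assumes "zero_bisimple (BwF \<F>)"
  obtains F where "F \<noteq> {}" "\<F> = {{}, F}"
proof -
  let ?S = "BwF \<F>"
  obtain z where z: "is_zero ?S z"
    and classes: "carrier ?S // green_D ?S = {carrier ?S - {z}, {z}}"
    using assms by (auto simp: zero_bisimple_def)
  have zero: "z = cls (i, j, {})" for i j
    using z by (rule is_zero_BwF)
  obtain X where X: "X \<in> carrier ?S" "carrier ?S - {z} = green_D ?S `` {X}"
    using classes by (metis insertI1 quotientE)
  obtain i j F where F: "F \<in> \<F>" and Xcls: "X = cls (i, j, F)"
    using X(1) by (auto simp: carrier_BwF)
  have "X \<in> carrier ?S - {z}"
    unfolding X(2) using X(1) by (auto simp: green_D_def green_L_def green_R_def)
  then have "F \<noteq> {}" using zero Xcls by auto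
  moreover have "G = F" if G: "G \<in> \<F>" "G \<noteq> {}" for G
  proof -
    have "cls (0, 0, G) \<in> carrier ?S - {z}"
      using G empty by (auto simp: carrier_BwF zero[of 0 0] cls_eq_iff)
    then have "(X, cls (0, 0, G)) \<in> green_D ?S" using X(2) by blast
    then show ?thesis using green_D_family[OF F G] Xcls by blast
  qed
  ultimately show ?thesis using that[of F] F empty by blast
qed

end

section \<open>Families with one nonempty member\<close>

text \<open>
  The analogue in \<open>\<omega>\<close> of the fact that subgroups of \<open>\<int>\<close> are cyclic: the least positive element
  divides all others, by division with remainder.
\<close>
lemma difference_closed_multiples:
  fixes D :: "nat set"
  assumes zero: "0 \<in> D"
    and add: "\<And>m n. m \<in> D \<Longrightarrow> n \<in> D \<Longrightarrow> m + n \<in> D"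
    and diff: "\<And>m n. m \<in> D \<Longrightarrow> n \<in> D \<Longrightarrow> n \<le> m \<Longrightarrow> m - n \<in> D"
  obtains d where "D = {d * i | i. True}"
proof (cases "D = {0}")
  case True
  then show ?thesis using that[of 0] by auto
next
  case False
  define d where "d = (LEAST n. n \<in> D \<and> 0 < n)"
  have "\<exists>n. n \<in> D \<and> 0 < n" using False zero by auto
  then have d: "d \<in> D" "0 < d" unfolding d_def by (metis (mono_tags, lifting) LeastI_ex)+
  have least: "d \<le> n" if "n \<in> D" "0 < n" for n
    unfolding d_def using that by (simp add: Least_le)
  have mult: "d * i \<in> D" for i
    by (induction i) (auto simp: zero add d)
  have "d dvd m" if "m \<in> D" for m
  proof -
    have "m - d * (m div d) \<in> D"
      by (rule diff[OF that mult]) (simp add: mult.commute)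
    then have "m mod d \<in> D" by (simp add: minus_mult_div_eq_mod)
    then have "m mod d = 0" using least[of "m mod d"] d(2) by (metis gr0I mod_less_divisor not_le)
    then show ?thesis by auto
  qed
  then have "D = {d * i | i. True}" using mult by (auto elim!: dvdE)
  then show ?thesis by (rule that)
qed

lemma omega_closed_pair:
  assumes closed: "omega_closed {{}, F}" and "F \<noteq> {}"
  obtains i0 d where "F = {i0 + d * i | i. True}"
proof -
  define i0 where "i0 = (LEAST n. n \<in> F)"
  have i0: "i0 \<in> F" using \<open>F \<noteq> {}\<close> unfolding i0_def by (metis LeastI ex_in_conv)
  have least: "i0 \<le> n" if "n \<in> F" for n
    unfolding i0_def using that by (rule Least_le)
  \<comment> \<open>One pair of points of \<open>F\<close> at distance \<open>n\<close> rules out an empty intersection,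
    so \<open>n\<close> translates all of \<open>F\<close> into \<open>F\<close>.\<close>
  have period: "b + n \<in> F" if "a \<in> F" "a + n \<in> F" "b \<in> F" for a b n
  proof -
    have "F \<inter> shift (- int n) F \<in> {{}, F}"
      using closed by (auto simp: omega_closed_def)
    moreover have "a \<in> F \<inter> shift (- int n) F"
      using that by (auto simp: shift_def intro!: bexI[of _ "a + n"])
    ultimately have "b \<in> shift (- int n) F" using that(3) by auto
    then obtain k where "k \<in> F" "int b = - int n + int k" by (auto simp: shift_def)
    moreover from this have "k = b + n" by linarith
    ultimately show ?thesis by simp
  qed
  \<comment> \<open>For \<open>n \<le> m\<close> in \<open>D\<close> the points \<open>i0 + n\<close> and \<open>i0 + m\<close> of \<open>F\<close> are at distance \<open>m - n\<close>.\<close>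
  define D where "D = {n. i0 + n \<in> F}"
  obtain d where d: "D = {d * i | i. True}"
  proof (rule difference_closed_multiples[of D])
    show "0 \<in> D" using i0 by (simp add: D_def)
    show "m + n \<in> D" if "m \<in> D" "n \<in> D" for m n
      using period[of i0 n "i0 + m"] that i0 by (simp add: D_def add.assoc)
    show "m - n \<in> D" if "m \<in> D" "n \<in> D" "n \<le> m" for m n
      using period[of "i0 + n" "m - n" i0] that i0 by (simp add: D_def)
  qed
  have "F = (+) i0 ` D"
  proof (intro subset_antisym subsetI)
    fix a assume "a \<in> F"
    then have "a = i0 + (a - i0)" "a - i0 \<in> D" using least by (simp_all add: D_def)
    then show "a \<in> (+) i0 ` D" by blast
  qed (auto simp: D_def)
  then have "F = {i0 + d * i | i. True}" unfolding d by auto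
  then show ?thesis by (rule that)
qed

lemma progression_Int_shift:
  fixes i0 d n :: nat
  defines "F \<equiv> {i0 + d * i | i. True}"
  shows "F \<inter> shift (- int n) F = (if d dvd n then F else {})"
proof -
  have "shift (- int n) F = {m. m + n \<in> F}"
    by (auto simp: mem_shift_iff nat_int_add)
  moreover have "m + n \<in> F \<longleftrightarrow> d dvd n" if mem: "m \<in> F" for m
  proof -
    obtain i where m: "m = i0 + d * i" using mem by (auto simp: F_def)
    have "m + n \<in> F \<longleftrightarrow> (\<exists>k. d * i + n = d * k)"
      unfolding m F_def by auto
    also have "\<dots> \<longleftrightarrow> d dvd n"
      by (metis dvd_add_right_iff dvd_def dvd_triv_left)
    finally show ?thesis .
  qed
  ultimately show ?thesis by auto
qed

section \<open>The model semigroups\<close>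

text \<open>
  The divisibility is between integers, so that \<open>d = 0\<close> requires \<open>j1 = i2\<close>. The carrier
  type and the unspecified unit are those of \<^const>\<open>matrix_units\<close>, which makes the case
  \<open>d = 0\<close> an equality.
\<close>
definition dvd_bicyclic :: "nat \<Rightarrow> (nat \<times> nat) option monoid" where
  "dvd_bicyclic d =
     \<lparr>carrier = UNIV,
      mult = (\<lambda>x y. case (x, y) of
                (Some (i1, j1), Some (i2, j2)) \<Rightarrow>
                  if int d dvd int j1 - int i2
                  then Some (i1 + i2 - min j1 i2, j1 + j2 - min j1 i2) else None
              | _ \<Rightarrow> None),
      one = undefined\<rparr>"

lemma carrier_dvd_bicyclic [simp]: "carrier (dvd_bicyclic d) = UNIV"
  by (simp add: dvd_bicyclic_def)

lemma mult_dvd_bicyclic [simp]: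
  "Some (i1, j1) \<otimes>\<^bsub>dvd_bicyclic d\<^esub> Some (i2, j2) =
     (if int d dvd int j1 - int i2
      then Some (i1 + i2 - min j1 i2, j1 + j2 - min j1 i2) else None)"
  "None \<otimes>\<^bsub>dvd_bicyclic d\<^esub> y = None"
  "x \<otimes>\<^bsub>dvd_bicyclic d\<^esub> None = None"
  by (auto simp: dvd_bicyclic_def split: option.split)

lemma matrix_units_eq: "matrix_units = dvd_bicyclic 0"
  unfolding matrix_units_def dvd_bicyclic_def
  by (auto simp: fun_eq_iff split: option.split)

lemma adjoin_zero_bicyclic_iso:
  shows "dvd_bicyclic 1 \<cong> adjoin_zero bicyclic" "adjoin_zero bicyclic \<cong> dvd_bicyclic 1"
proof -
  have "carrier (adjoin_zero bicyclic) = UNIV"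
    by (auto simp: adjoin_zero_def bicyclic_def) (metis not_Some_eq rangeI)
  moreover have "x \<otimes>\<^bsub>adjoin_zero bicyclic\<^esub> y = x \<otimes>\<^bsub>dvd_bicyclic 1\<^esub> y" for x y
    by (auto simp: adjoin_zero_def bicyclic_def dvd_bicyclic_def split: option.split)
  ultimately have "id \<in> iso (dvd_bicyclic 1) (adjoin_zero bicyclic)"
    "id \<in> iso (adjoin_zero bicyclic) (dvd_bicyclic 1)"
    by (simp_all add: iso_def hom_def)
  then show "dvd_bicyclic 1 \<cong> adjoin_zero bicyclic" "adjoin_zero bicyclic \<cong> dvd_bicyclic 1"
    by (auto intro: is_isoI)
qed

text \<open>
  Only shifts by nonpositive amounts occur in a product, so by \<open>progression_Int_shift\<close> the start
  \<open>i0\<close> of the progression does not enter the multiplication.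
\<close>
lemma BwF_progression_iso:
  fixes i0 d :: nat
  defines "F \<equiv> {i0 + d * i | i. True}"
  shows "dvd_bicyclic d \<cong> BwF {{}, F}" "BwF {{}, F} \<cong> dvd_bicyclic d"
proof -
  note Int_shift = progression_Int_shift[of i0 d, folded F_def]
  have "F \<noteq> {}" by (auto simp: F_def)
  interpret omega_family "{{}, F}"
    by standard (auto simp: omega_closed_def Int_shift)
  let ?S = "BwF {{}, F}"
  define Z where "Z = cls (0, 0, {})"
  have Z: "cls (i, j, {}) = Z" for i j
    by (simp add: Z_def cls_eq_iff)
  define h where "h x = (case x of None \<Rightarrow> Z | Some (i, j) \<Rightarrow> cls (i, j, F))" for x
  have mult: "bw_mult (i1, j1, F) (i2, j2, F) =
     (i1 + i2 - min j1 i2, j1 + j2 - min j1 i2, if int d dvd int j1 - int i2 then F else {})"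
    for i1 j1 i2 j2
  proof (cases "j1 \<le> i2")
    case True
    then have "int j1 - int i2 = - int (i2 - j1)" by simp
    then show ?thesis using True Int_shift[of "i2 - j1"]
      by (simp add: Int_commute min_def del: of_nat_diff)
  next
    case False
    then have eqs: "int i2 - int j1 = - int (j1 - i2)" "int j1 - int i2 = int (j1 - i2)"
      by simp_all
    have "F \<inter> shift (int i2 - int j1) F = (if int d dvd int j1 - int i2 then F else {})"
      unfolding eqs Int_shift by simp
    then show ?thesis using False by (simp add: min_def)
  qed
  have "h (x \<otimes>\<^bsub>dvd_bicyclic d\<^esub> y) = h x \<otimes>\<^bsub>?S\<^esub> h y" for x y
  proof -
    have "Z \<otimes>\<^bsub>?S\<^esub> cls (k, l, G) = Z" "cls (k, l, G) \<otimes>\<^bsub>?S\<^esub> Z = Z" if "G \<in> {{}, F}" for k l G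
      using that by (auto simp: Z_def mult_cls cls_eq_iff)
    from this[of "{}"] this[of F] show ?thesis
      by (cases x; cases y)
        (auto simp: h_def Z mult_cls mult simp del: bw_mult.simps)
  qed
  moreover have "bij_betw h UNIV (carrier ?S)"
  proof (rule bij_betw_imageI)
    show "inj h"
      using \<open>F \<noteq> {}\<close> by (auto simp: inj_def h_def Z_def cls_eq_iff split: option.split)
    show "range h = carrier ?S"
    proof (intro subset_antisym subsetI)
      fix A assume "A \<in> carrier ?S"
      then obtain i j G where "G = {} \<or> G = F" "A = cls (i, j, G)"
        by (auto simp: carrier_BwF)
      then have "A = h None \<or> A = h (Some (i, j))"
        by (auto simp: h_def Z)
      then show "A \<in> range h" by auto
    qed (auto simp: h_def Z_def carrier_BwF split: option.split)
  qed
  ultimately have "h \<in> iso (dvd_bicyclic d) ?S"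
    by (auto simp: iso_def hom_def dest: bij_betwE)
  then show "dvd_bicyclic d \<cong> ?S" by (rule is_isoI)
  then show "?S \<cong> dvd_bicyclic d" by (rule iso_sym_closed[rotated]) simp
qed

lemma dvd_bicyclic_zero_divisors:
  "(\<exists>x y. x \<noteq> None \<and> y \<noteq> None \<and> x \<otimes>\<^bsub>dvd_bicyclic d\<^esub> y = None) \<longleftrightarrow> d \<noteq> 1"
proof
  assume "d \<noteq> 1"
  then have "Some (0, 0) \<otimes>\<^bsub>dvd_bicyclic d\<^esub> Some (1, 1) = None" by simp
  then show "\<exists>x y. x \<noteq> None \<and> y \<noteq> None \<and> x \<otimes>\<^bsub>dvd_bicyclic d\<^esub> y = None" by blast
qed auto

text \<open>
  The nonzero idempotents are the diagonal pairs. Distinct ones are orthogonal for \<open>d = 0\<close>,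
  whereas for \<open>d > 0\<close> the pair \<open>(d, d)\<close> lies below \<open>(0, 0)\<close>.
\<close>
lemma dvd_bicyclic_idempotents:
  "(\<exists>e f. e \<otimes>\<^bsub>dvd_bicyclic d\<^esub> e = e \<and> f \<otimes>\<^bsub>dvd_bicyclic d\<^esub> f = f \<and> e \<noteq> f \<and>
      e \<otimes>\<^bsub>dvd_bicyclic d\<^esub> f \<noteq> None) \<longleftrightarrow> d \<noteq> 0"
    (is "?P \<longleftrightarrow> _")
proof
  assume ?P
  then obtain e f where ef: "e \<otimes>\<^bsub>dvd_bicyclic d\<^esub> e = e" "f \<otimes>\<^bsub>dvd_bicyclic d\<^esub> f = f" "e \<noteq> f"
      "e \<otimes>\<^bsub>dvd_bicyclic d\<^esub> f \<noteq> None" by blast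
  then obtain i j k l where [simp]: "e = Some (i, j)" "f = Some (k, l)"
    by (cases e; cases f) auto
  have "i = j" "k = l" using ef(1,2) by (auto split: if_splits)
  then show "d \<noteq> 0" using ef(3,4) by (cases "d = 0") (auto split: if_splits)
next
  assume "d \<noteq> 0"
  then show ?P
    by (intro exI[of _ "Some (0, 0)"] exI[of _ "Some (d, d)"]) simp
qed

text \<open>
  An isomorphism preserves the zero, and therefore the two properties of the preceding lemmas.
\<close>
lemma dvd_bicyclic_iso_imp:
  assumes "dvd_bicyclic d \<cong> dvd_bicyclic d'"
  shows "d = 0 \<longleftrightarrow> d' = 0" "d = 1 \<longleftrightarrow> d' = 1"
proof -
  obtain h where h: "bij h"
    and hom: "\<And>x y. h (x \<otimes>\<^bsub>dvd_bicyclic d\<^esub> y) = h x \<otimes>\<^bsub>dvd_bicyclic d'\<^esub> h y"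
    using assms by (auto simp: is_iso_def iso_def hom_def)
  have inj: "h x = h y \<longleftrightarrow> x = y" for x y using h by (simp add: bij_is_inj inj_eq)
  have all: "(\<exists>x. P (h x)) \<longleftrightarrow> (\<exists>x. P x)" for P using h by (metis bij_pointE)
  obtain u where "h u = None" using h by (metis bij_pointE)
  then have None: "h None = None"
    using hom[of u None] by simp
  then have zero: "h x = None \<longleftrightarrow> x = None" for x using inj by metis
  have "d \<noteq> 1 \<longleftrightarrow> d' \<noteq> 1"
    unfolding dvd_bicyclic_zero_divisors[symmetric]
    by (subst (3) all[symmetric], subst (4) all[symmetric]) (simp add: zero flip: hom)
  then show "d = 1 \<longleftrightarrow> d' = 1" by blast
  have "d \<noteq> 0 \<longleftrightarrow> d' \<noteq> 0"
    unfolding dvd_bicyclic_idempotents[symmetric]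
    by (subst (3) all[symmetric], subst (4) all[symmetric]) (simp add: zero inj flip: hom)
  then show "d = 0 \<longleftrightarrow> d' = 0" by blast
qed

section \<open>The classification\<close>

theorem mainTheorem12:
  fixes \<F> :: "nat set set"
  assumes "omega_closed \<F>"
    and "{} \<in> \<F>"
    and "zero_bisimple (BwF \<F>)"
  shows "exactly_one_of_three
           (BwF \<F> \<cong> matrix_units)
           (BwF \<F> \<cong> adjoin_zero bicyclic)
           (\<exists>j0::nat. j0 \<ge> 2 \<and> BwF \<F> \<cong> Bw_progression 0 j0)"
proof -
  interpret omega_family \<F>
    using assms by unfold_locales
  obtain F where "F \<noteq> {}" and \<F>: "\<F> = {{}, F}"
    using zero_bisimple_family[OF assms(3)] .
  then obtain i0 d where "F = {i0 + d * i | i. True}"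
    using omega_closed_pair assms(1) by metis
  then have d: "dvd_bicyclic d \<cong> BwF \<F>" "BwF \<F> \<cong> dvd_bicyclic d"
    using BwF_progression_iso(1)[of d i0] BwF_progression_iso(2)[of i0 d] by (simp_all add: \<F>)
  have iso_d: "BwF \<F> \<cong> dvd_bicyclic d' \<longleftrightarrow> dvd_bicyclic d \<cong> dvd_bicyclic d'" for d'
    using d by (blast intro: iso_trans)
  have "BwF \<F> \<cong> matrix_units \<longleftrightarrow> d = 0"
    unfolding matrix_units_eq iso_d using dvd_bicyclic_iso_imp(1)[of d 0] by auto
  moreover have "BwF \<F> \<cong> adjoin_zero bicyclic \<longleftrightarrow> d = 1"
  proof -
    have "BwF \<F> \<cong> adjoin_zero bicyclic \<longleftrightarrow> BwF \<F> \<cong> dvd_bicyclic 1"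
      using adjoin_zero_bicyclic_iso by (blast intro: iso_trans)
    then show ?thesis
      unfolding iso_d using dvd_bicyclic_iso_imp(2)[of d 1] by auto
  qed
  moreover have "(\<exists>j0\<ge>2. BwF \<F> \<cong> Bw_progression 0 j0) \<longleftrightarrow> 2 \<le> d"
  proof -
    have "BwF \<F> \<cong> Bw_progression 0 j0 \<longleftrightarrow> BwF \<F> \<cong> dvd_bicyclic j0" for j0
      unfolding Bw_progression_def using BwF_progression_iso(1)[of j0 0] BwF_progression_iso(2)[of 0 j0]
      by (auto intro: iso_trans)
    then have "(\<exists>j0\<ge>2. BwF \<F> \<cong> Bw_progression 0 j0) \<longleftrightarrow> (\<exists>j0\<ge>2. dvd_bicyclic d \<cong> dvd_bicyclic j0)"
      unfolding iso_d by simp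
    also have "\<dots> \<longleftrightarrow> 2 \<le> d"
    proof
      assume "\<exists>j0\<ge>2. dvd_bicyclic d \<cong> dvd_bicyclic j0"
      then obtain j0 where "2 \<le> j0" "dvd_bicyclic d \<cong> dvd_bicyclic j0" by blast
      with dvd_bicyclic_iso_imp[OF this(2)] show "2 \<le> d" by linarith
    qed auto
    finally show ?thesis .
  qed
  ultimately show ?thesis
    unfolding exactly_one_of_three_def by (simp only:) presburger
qed

end
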